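(* Let $\{\varphi_n\}_{n=0}^\infty$ be a linearly dense stationary sequence of unit vectors in a Hilbert space $H$ with singular spectral measure $\mu$, with associated coefficient sequence $\{\alpha_n\}_{n\ge0}$. Let $r\in(0,1)$ be fixed and let $\{c_n\}_{n=0}^\infty\subset\mathbb{C}$. Define the augmented Kaczmarz algorithm by $\vec{x}_{-1}=\vec{y}_{-1}=0$ and, for $n\ge0$, $$\vec{x}_n=\vec{x}_{n-1}+c_n\varphi_n-\langle\vec{x}_{n-1},\varphi_n\rangle\varphi_n,\qquad \vec{y}_n=\vec{y}_{n-1}+r^n\langle\vec{x}_n-\vec{x}_{n-1},\varphi_n\rangle\varphi_n.$$ Then for every $N\ge0$, $$\vec{y}_N=\sum_{n=0}^N r^n\Big(\sum_{j=0}^n\alpha_{n-j}c_j\Big)\varphi_n.$$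
   Context: $H$ is a complex Hilbert space with inner product linear in the first variable. A sequence $\{\varphi_n\}_{n=0}^\infty$ of unit vectors is stationary if $\langle\varphi_{n+k},\varphi_{m+k}\rangle=\langle\varphi_n,\varphi_m\rangle$ for all $n,m,k\in\mathbb{N}_0$. Its spectral measure is the Borel probability measure $\mu$ on $[0,1)$ with $\langle\varphi_n,\varphi_m\rangle=\int_0^1 e^{2\pi i(n-m)x}\,d\mu(x)$; it is singular if it is singular with respect to Lebesgue measure. Linearly dense means the linear span is dense in $H$. Let $\mu^+(z)=\int_0^1\frac{1}{1-ze^{-2\pi i x}}\,d\mu(x)$ for $z$ in the open unit disc $\mathbb{D}$, and $b(z)=1-\frac{1}{\mu^+(z)}$. The sequence $\{\alpha_n\}$ is defined by $1-b(z)=\sum_{n=0}^\infty\alpha_n z^n$. *)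

theory Defs
  imports "HOL-Analysis.Analysis" "HOL-Probability.Probability_Measure"
begin

text \<open>Complex Hilbert spaces; the inner product is linear in its first argument.\<close>

class complex_hilbert = banach +
  fixes scaleC :: "complex \<Rightarrow> 'a \<Rightarrow> 'a" (infixr "*\<^sub>C" 75)
    and cinner :: "'a \<Rightarrow> 'a \<Rightarrow> complex"
  assumes scaleC_add_right: "a *\<^sub>C (x + y) = a *\<^sub>C x + a *\<^sub>C y"
    and scaleC_add_left: "(a + b) *\<^sub>C x = a *\<^sub>C x + b *\<^sub>C x"
    and scaleC_scaleC: "a *\<^sub>C b *\<^sub>C x = (a * b) *\<^sub>C x"
    and scaleC_of_real: "complex_of_real t *\<^sub>C x = t *\<^sub>R x"
    and cinner_add_left: "cinner (x + y) z = cinner x z + cinner y z"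
    and cinner_scaleC_left: "cinner (a *\<^sub>C x) y = a * cinner x y"
    and cinner_commute: "cinner x y = cnj (cinner y x)"
    and cinner_self: "cinner x x = complex_of_real ((norm x)\<^sup>2)"

global_interpretation complex_vector: vector_space "scaleC :: complex \<Rightarrow> 'a \<Rightarrow> 'a::complex_hilbert"
proof
  show "1 *\<^sub>C x = x" for x :: 'a
    using scaleC_of_real[of 1 x] by simp
qed (rule scaleC_add_right scaleC_add_left scaleC_scaleC)+

instantiation complex :: complex_hilbert
begin

definition scaleC_complex :: "complex \<Rightarrow> complex \<Rightarrow> complex"
  where "scaleC_complex a x = a * x"

definition cinner_complex :: "complex \<Rightarrow> complex \<Rightarrow> complex"
  where "cinner_complex x y = x * cnj y"

instance
proof
  fix x y z a b :: complex and t :: real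
  show "a *\<^sub>C (x + y) = a *\<^sub>C x + a *\<^sub>C y" "(a + b) *\<^sub>C x = a *\<^sub>C x + b *\<^sub>C x"
    "a *\<^sub>C b *\<^sub>C x = (a * b) *\<^sub>C x"
    by (simp_all add: scaleC_complex_def distrib_left distrib_right)
  show "complex_of_real t *\<^sub>C x = t *\<^sub>R x"
    by (simp add: scaleC_complex_def scaleR_conv_of_real)
  show "cinner (x + y) z = cinner x z + cinner y z" "cinner (a *\<^sub>C x) y = a * cinner x y"
    "cinner x y = cnj (cinner y x)"
    by (simp_all add: scaleC_complex_def cinner_complex_def distrib_right)
  show "cinner x x = complex_of_real ((norm x)\<^sup>2)"
    unfolding cinner_complex_def by (rule complex_norm_square[symmetric])
qed

end

definition linearly_dense :: "(nat \<Rightarrow> 'a::complex_hilbert) \<Rightarrow> bool"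
  where "linearly_dense \<phi> \<longleftrightarrow> closure (complex_vector.span (range \<phi>)) = UNIV"

definition stationary :: "(nat \<Rightarrow> 'a::complex_hilbert) \<Rightarrow> bool"
  where "stationary \<phi> \<longleftrightarrow>
    (\<forall>n m k. cinner (\<phi> (n + k)) (\<phi> (m + k)) = cinner (\<phi> n) (\<phi> m))"

definition spectral_measure :: "(nat \<Rightarrow> 'a::complex_hilbert) \<Rightarrow> real measure \<Rightarrow> bool"
  where "spectral_measure \<phi> \<mu> \<longleftrightarrow>
    sets \<mu> = sets (restrict_space borel {0..<1}) \<and> prob_space \<mu> \<and>
    (\<forall>n m. cinner (\<phi> n) (\<phi> m) = (LINT x|\<mu>. cis (2 * pi * (real n - real m) * x)))"

definition mutually_singular :: "'a measure \<Rightarrow> 'a measure \<Rightarrow> bool"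
  where "mutually_singular M N \<longleftrightarrow> sets M = sets N \<and>
    (\<exists>A\<in>sets M. emeasure M A = 0 \<and> emeasure N (space N - A) = 0)"

definition mu_plus :: "real measure \<Rightarrow> complex \<Rightarrow> complex"
  where "mu_plus \<mu> z = (LINT x|\<mu>. 1 / (1 - z * cis (- (2 * pi * x))))"

definition b_fun :: "real measure \<Rightarrow> complex \<Rightarrow> complex"
  where "b_fun \<mu> z = 1 - 1 / mu_plus \<mu> z"

definition associated_coeffs :: "real measure \<Rightarrow> (nat \<Rightarrow> complex) \<Rightarrow> bool"
  where "associated_coeffs \<mu> \<alpha> \<longleftrightarrow>
    (\<forall>z\<in>ball 0 1. (\<lambda>n. \<alpha> n * z ^ n) sums (1 - b_fun \<mu> z))"

end

theory Submission
  imports Defs "HOL-Complex_Analysis.Laurent_Convergence"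
begin

text \<open>
  Write \<open>x\<^sub>n - x\<^sub>n\<^sub>-\<^sub>1 = d\<^sub>n \<phi>\<^sub>n\<close> and \<open>g\<^sub>m = \<langle>\<phi>\<^sub>0, \<phi>\<^sub>m\<rangle>\<close>. By stationarity the recursion for
  \<open>x\<close> says that \<open>c\<close> is the Cauchy product of \<open>d\<close> and \<open>g\<close>. Expanding the Cauchy kernel as a
  geometric series shows that \<open>g\<close> is the coefficient sequence of \<open>\<mu>\<^sup>+\<close>, and \<open>\<alpha>\<close> is that of
  \<open>1 / \<mu>\<^sup>+\<close>; hence \<open>d\<close> is the Cauchy product of \<open>c\<close> and \<open>\<alpha>\<close>.
\<close>

lemma cinner_sum_scaleC_left:
  "cinner (\<Sum>k\<in>K. a k *\<^sub>C f k) z = (\<Sum>k\<in>K. a k * cinner (f k) z)"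
proof -
  have "cinner 0 z = 0"
    using cinner_add_left[of 0 0 z] by simp
  then show ?thesis
    by (induction K rule: infinite_finite_induct) (simp_all add: cinner_add_left cinner_scaleC_left)
qed

lemma mu_plus_sums:
  fixes \<mu> :: "real measure"
  assumes "prob_space \<mu>" and sets: "sets \<mu> = sets (restrict_space borel {0..<1})"
    and z: "norm z < 1"
  shows "(\<lambda>n. (LINT x|\<mu>. cis (- (2 * pi * real n * x))) * z ^ n) sums mu_plus \<mu> z"
proof -
  interpret prob_space \<mu> by fact
  define f where "f n x = z ^ n * cis (- (2 * pi * real n * x))" for n x
  have meas [measurable]: "(\<lambda>x. cis (- (2 * pi * real n * x))) \<in> borel_measurable \<mu>" for n
  proof -
    have "(\<lambda>x. cis (- (2 * pi * real n * x))) \<in> borel_measurable (borel :: real measure)"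
      by (intro borel_measurable_continuous_onI continuous_intros)
    then have "(\<lambda>x. cis (- (2 * pi * real n * x))) \<in> borel_measurable (restrict_space borel {0..<1})"
      by (rule measurable_restrict_space1)
    then show ?thesis
      using measurable_cong_sets[OF sets refl] by blast
  qed
  have norm_f: "norm (f n x) = norm z ^ n" for n x
    by (simp add: f_def norm_mult norm_power)
  have int: "integrable \<mu> (f n)" for n
    by (rule integrable_const_bound[where B = "norm z ^ n"])
      (simp add: norm_f, unfold f_def, measurable)
  have f_sums: "(\<lambda>n. f n x) sums (1 / (1 - z * cis (- (2 * pi * x))))" for x
  proof -
    have "f n x = (z * cis (- (2 * pi * x))) ^ n" for n
      by (simp add: f_def power_mult_distrib Complex.DeMoivre mult_ac)
    then show ?thesis
      using geometric_sums[of "z * cis (- (2 * pi * x))"] z by (simp add: norm_mult)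
  qed
  \<comment> \<open>Sum and integral may be exchanged: \<open>norm (f n x)\<close> is the constant
    \<open>norm z ^ n\<close> and the total mass is 1, so the norms and their integrals are both
    dominated by a convergent geometric series.\<close>
  have "(\<lambda>n. integral\<^sup>L \<mu> (f n)) sums (LINT x|\<mu>. (\<Sum>n. f n x))"
    by (rule sums_integral) (use int z in \<open>simp_all add: norm_f prob_space summable_geometric\<close>)
  moreover have "(LINT x|\<mu>. (\<Sum>n. f n x)) = mu_plus \<mu> z"
    unfolding mu_plus_def using f_sums by (simp add: sums_iff)
  moreover have "integral\<^sup>L \<mu> (f n) = (LINT x|\<mu>. cis (- (2 * pi * real n * x))) * z ^ n" for n
    unfolding f_def by simp
  ultimately show ?thesis
    by simp
qed

text \<open>Bridge from convergence on the unit disc to formal power series, where reciprocals and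
  uniqueness of coefficients become algebra. Convergence at every real point of (0,1) already forces
  radius at least 1.\<close>

lemma has_fps_expansion_of_sums:
  fixes a :: "nat \<Rightarrow> complex"
  assumes "\<And>z. norm z < 1 \<Longrightarrow> (\<lambda>n. a n * z ^ n) sums f z"
  shows "f has_fps_expansion Abs_fps a"
proof -
  have "1 \<le> conv_radius a"
    by (rule conv_radius_geI_ex') (use assms in \<open>auto simp: sums_iff\<close>)
  then have "0 < fps_conv_radius (Abs_fps a)"
    by (auto simp: fps_conv_radius_def intro: less_le_trans[of 0 1])
  moreover have "eventually (\<lambda>z. eval_fps (Abs_fps a) z = f z) (nhds 0)"
    unfolding eventually_nhds_metric
    using assms by (auto simp: eval_fps_def sums_iff intro!: exI[of _ 1])
  ultimately show ?thesis
    by (simp add: has_fps_expansion_def)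
qed

lemma associated_coeffs_mult_moments:
  assumes "prob_space \<mu>" "sets \<mu> = sets (restrict_space borel {0..<1})"
    and "associated_coeffs \<mu> \<alpha>"
  shows "Abs_fps \<alpha> * Abs_fps (\<lambda>n. LINT x|\<mu>. cis (- (2 * pi * real n * x))) = 1"
proof -
  interpret prob_space \<mu> by fact
  let ?G = "Abs_fps (\<lambda>n. LINT x|\<mu>. cis (- (2 * pi * real n * x)))"
  have "mu_plus \<mu> has_fps_expansion ?G"
    by (intro has_fps_expansion_of_sums mu_plus_sums assms)
  \<comment> \<open>The constant coefficient of \<open>?G\<close> is the total mass 1, hence
    nonzero, so the formal inverse exists.\<close>
  then have "(\<lambda>z. inverse (mu_plus \<mu> z)) has_fps_expansion inverse ?G"
    by (rule has_fps_expansion_inverse) (simp add: prob_space)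
  moreover have "(\<lambda>z. inverse (mu_plus \<mu> z)) has_fps_expansion Abs_fps \<alpha>"
    by (rule has_fps_expansion_of_sums)
      (use assms(3) in \<open>simp add: associated_coeffs_def b_fun_def inverse_eq_divide\<close>)
  ultimately have "Abs_fps \<alpha> = inverse ?G"
    using fps_expansion_unique_complex by blast
  then show ?thesis
    by (simp add: inverse_mult_eq_1 prob_space)
qed

theorem theorem5:
  fixes \<phi> :: "nat \<Rightarrow> 'a::complex_hilbert"
    and \<mu> :: "real measure"
    and \<alpha> c :: "nat \<Rightarrow> complex"
    and r :: real
    and x y :: "int \<Rightarrow> 'a"
  assumes "\<And>n. norm (\<phi> n) = 1"
    and "stationary \<phi>"
    and "linearly_dense \<phi>"
    and "spectral_measure \<phi> \<mu>"
    and "mutually_singular \<mu> (restrict_space lborel {0..<1})"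
    and "associated_coeffs \<mu> \<alpha>"
    and "0 < r" "r < 1"
    and "x (- 1) = 0" "y (- 1) = 0"
    and "\<And>n::nat. x (int n) =
      x (int n - 1) + c n *\<^sub>C \<phi> n - cinner (x (int n - 1)) (\<phi> n) *\<^sub>C \<phi> n"
    and "\<And>n::nat. y (int n) =
      y (int n - 1) + complex_of_real (r ^ n) *\<^sub>C cinner (x (int n) - x (int n - 1)) (\<phi> n) *\<^sub>C \<phi> n"
  shows "\<forall>N::nat. y (int N) =
    (\<Sum>n=0..N. (complex_of_real (r ^ n) * (\<Sum>j=0..n. \<alpha> (n - j) * c j)) *\<^sub>C \<phi> n)"
proof -
  define d where "d n = c n - cinner (x (int n - 1)) (\<phi> n)" for n
  define g where "g m = cinner (\<phi> 0) (\<phi> m)" for m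
  have step: "x (int n) = x (int n - 1) + d n *\<^sub>C \<phi> n" for n
    using assms(11)[of n] by (simp add: d_def complex_vector.scale_left_diff_distrib)
  \<comment> \<open>Indexing by \<open>n - 1\<close> turns the initial value at -1 into the empty
    sum.\<close>
  have x_sum: "x (int n - 1) = (\<Sum>k<n. d k *\<^sub>C \<phi> k)" for n
  proof (induction n)
    case 0
    then show ?case using assms(9) by simp
  next
    case (Suc n)
    then show ?case using step[of n] by simp
  qed
  have gram: "cinner (\<phi> k) (\<phi> n) = g (n - k)" if "k \<le> n" for k n
    using assms(2) that unfolding stationary_def g_def by (metis add_0 le_add_diff_inverse2)
  have unit: "cinner (\<phi> n) (\<phi> n) = 1" for n
    by (simp add: cinner_self assms(1))
  have "Abs_fps c = Abs_fps d * Abs_fps g"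
  proof (rule fps_ext)
    fix n
    \<comment> \<open>The definition of \<open>d n\<close> is solved for \<open>c n\<close>; since
      \<open>\<phi> n\<close> is a unit vector, the lone \<open>d n\<close> is the missing diagonal
      term \<open>k = n\<close>.\<close>
    have "c n = (\<Sum>k<n. d k * cinner (\<phi> k) (\<phi> n)) + d n * cinner (\<phi> n) (\<phi> n)"
      using d_def[of n] by (simp add: x_sum cinner_sum_scaleC_left unit)
    also have "\<dots> = (\<Sum>k=0..n. d k * cinner (\<phi> k) (\<phi> n))"
      by (simp add: atLeast0AtMost flip: lessThan_Suc_atMost)
    also have "\<dots> = (\<Sum>k=0..n. d k * g (n - k))"
      by (intro sum.cong) (simp_all add: gram)
    finally show "fps_nth (Abs_fps c) n = fps_nth (Abs_fps d * Abs_fps g) n"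
      by (simp add: fps_mult_nth)
  qed
  moreover have "Abs_fps \<alpha> * Abs_fps g = 1"
  proof -
    \<comment> \<open>The vector \<open>\<phi> 0\<close> stands in the first slot, so the frequency
      is \<open>0 - n\<close>, the sign that occurs in the kernel of \<open>mu_plus\<close>.\<close>
    have "g = (\<lambda>n. LINT x|\<mu>. cis (- (2 * pi * real n * x)))"
      using assms(4) by (simp add: spectral_measure_def g_def fun_eq_iff)
    then show ?thesis
      using associated_coeffs_mult_moments[of \<mu> \<alpha>] assms(4,6) by (simp add: spectral_measure_def)
  qed
  ultimately have "Abs_fps d = Abs_fps c * Abs_fps \<alpha>"
    by (simp add: mult.assoc mult.commute[of "Abs_fps g"])
  then have d: "d n = (\<Sum>j=0..n. \<alpha> (n - j) * c j)" for n
    unfolding fps_eq_iff fps_mult_nth by (simp add: mult.commute[of "\<alpha> _"])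
  \<comment> \<open>The inner product in the recursion for \<open>y\<close> is that of
    \<open>d n *\<^sub>C \<phi> n\<close> with the unit vector \<open>\<phi> n\<close>, which is
    \<open>d n\<close>.\<close>
  have ystep: "y (int n) = y (int n - 1) + (complex_of_real (r ^ n) * d n) *\<^sub>C \<phi> n" for n
    using assms(12)[of n] step[of n] by (simp add: cinner_scaleC_left unit scaleC_scaleC)
  have "y (int N) = (\<Sum>n=0..N. (complex_of_real (r ^ n) * d n) *\<^sub>C \<phi> n)" for N
  proof (induction N)
    case 0
    then show ?case using ystep[of 0] assms(10) by simp
  next
    case (Suc N)
    then show ?case using ystep[of "Suc N"] by simp
  qed
  then show ?thesis
    by (simp add: d)
qed

end
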